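(* Let $\mathbb{K}$ be a field of characteristic zero and $R$ a unital commutative associative $\mathbb{K}$-algebra. If $N$ is a projective left $R$-module, then its corresponding $(\mathbb{K},R)$-Lie algebra $\mathcal{CDO}(N)$ is transitive.
   Context: $T_R:=\mathrm{Der}(R)$ is the $R$-module and Lie algebra (under commutators) of all $\mathbb{K}$-linear derivations $R\to R$. A $(\mathbb{K},R)$-Lie algebra (Lie-Rinehart algebra) is a unital left $R$-module $L$ with an $R$-linear map $\rho\colon L\to T_R$ (the anchor) and a Lie algebra structure $[\cdot,\cdot]$ on $L$ over $\mathbb{K}$ such that $\rho$ is a Lie algebra homomorphism and $[\ell_1,r\cdot\ell_2]=r\cdot[\ell_1,\ell_2]+(\rho(\ell_1)r)\cdot\ell_2$ for all $r\in R$, $\ell_1,\ell_2\in L$. It is called transitive if its anchor $\rho\colon L\to T_R$ is surjective. For an $R$-module $N$ and $r\in R$ let $\mu^N(r)\colon N\to N$, $n\mapsto rn$, and define $$\mathcal{CDO}(N):=\{(D,X)\in\mathrm{End}_{\mathbb{K}}(N)\times\mathrm{Der}(R)\mid[D,\mu^N(r)]=\mu^N(X(r))\text{ for all }r\in R\},$$ i.e. $D(rn)=rD(n)+X(r)n$ for all $r\in R$, $n\in N$. It is a Lie subalgebra and an $R$-submodule of $\mathrm{End}_{\mathbb{K}}(N)\times\mathrm{Der}(R)$ (with $r\cdot(D,X)=(\mu^N(r)D,rX)$), and it is a $(\mathbb{K},R)$-Lie algebra with anchor $\rho^{\mathcal{CDO}(N)}\colon\mathcal{CDO}(N)\to\mathrm{Der}(R)$,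 $(D,X)\mapsto X$. *)

theory Defs
  imports "HOL-Algebra.Module"
begin

section \<open>Modules over a commutative ring\<close>

definition characteristic_zero :: "('k, 'm) ring_scheme \<Rightarrow> bool" where
  "characteristic_zero K \<longleftrightarrow> (\<forall>n::nat. 0 < n \<longrightarrow> [n] \<cdot>\<^bsub>K\<^esub> \<one>\<^bsub>K\<^esub> \<noteq> \<zero>\<^bsub>K\<^esub>)"

definition linear_maps ::
  "('r, 'm) ring_scheme \<Rightarrow> ('r, 'a, 'p) module_scheme \<Rightarrow> ('r, 'b, 'q) module_scheme \<Rightarrow> ('a \<Rightarrow> 'b) set"
  where
  "linear_maps R M N =
     {f \<in> carrier M \<rightarrow> carrier N.
        (\<forall>x\<in>carrier M. \<forall>y\<in>carrier M. f (x \<oplus>\<^bsub>M\<^esub> y) = f x \<oplus>\<^bsub>N\<^esub> f y) \<and>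
        (\<forall>r\<in>carrier R. \<forall>x\<in>carrier M. f (r \<odot>\<^bsub>M\<^esub> x) = r \<odot>\<^bsub>N\<^esub> f x)}"

text \<open>
  Projectivity is the lifting property against surjections \<open>f : A \<rightarrow> B\<close>. HOL cannot quantify over
  types inside a definition, so the test modules live on the fixed types \<^typ>\<open>'n \<Rightarrow> 'r\<close> and
  \<^typ>\<open>'n\<close>. These are large enough for the free module on the underlying set of \<open>N\<close> and for
  \<open>N\<close> itself; the fact \<open>projective_module_lift\<close> below shows that the lifting property against
  test modules on arbitrary types follows.
\<close>

definition projective_module :: "('r, 'm) ring_scheme \<Rightarrow> ('r, 'n, 'p) module_scheme \<Rightarrow> bool" where
  "projective_module R N \<longleftrightarrow> module R N \<and>
     (\<forall>(A :: ('r, 'n \<Rightarrow> 'r) module) (B :: ('r, 'n) module) f g.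
        module R A \<and> module R B \<and>
        f \<in> linear_maps R A B \<and> f ` carrier A = carrier B \<and> g \<in> linear_maps R N B
        \<longrightarrow> (\<exists>h\<in>linear_maps R N A. \<forall>x\<in>carrier N. f (h x) = g x))"

text \<open>
  For a \<open>K\<close>-algebra \<open>R\<close>, this is the \<open>K\<close>-module underlying an \<open>R\<close>-module \<open>N\<close>. As for all modules of
  HOL-Algebra, the multiplicative fields of the record are irrelevant.
\<close>

definition restrict_scalars ::
  "('k, 'r, 'm) module_scheme \<Rightarrow> ('r, 'n, 'p) module_scheme \<Rightarrow> ('k, 'n) module" where
  "restrict_scalars R N =
     \<lparr>carrier = carrier N, monoid.mult = monoid.mult N, one = one N,
      ring.zero = ring.zero N, ring.add = ring.add N,
      smult = (\<lambda>k x. (k \<odot>\<^bsub>R\<^esub> \<one>\<^bsub>R\<^esub>) \<odot>\<^bsub>N\<^esub> x)\<rparr>"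


section \<open>Endomorphisms and derivations\<close>

text \<open>
  Maps are taken to be extensional (\<^const>\<open>undefined\<close> outside the carrier), so that equality of
  maps is equality on the carrier.
\<close>

definition endomorphisms ::
  "('k, 'a) ring_scheme \<Rightarrow> ('k, 'r, 'm) module_scheme \<Rightarrow> ('r, 'n, 'p) module_scheme \<Rightarrow> ('n \<Rightarrow> 'n) set"
  where
  "endomorphisms K R N =
     linear_maps K (restrict_scalars R N) (restrict_scalars R N) \<inter> extensional (carrier N)"

definition derivations ::
  "('k, 'a) ring_scheme \<Rightarrow> ('k, 'r, 'm) module_scheme \<Rightarrow> ('r \<Rightarrow> 'r) set" where
  "derivations K R =
     {X \<in> linear_maps K R R \<inter> extensional (carrier R).
        \<forall>a\<in>carrier R. \<forall>b\<in>carrier R. X (a \<otimes>\<^bsub>R\<^esub> b) = a \<otimes>\<^bsub>R\<^esub> X b \<oplus>\<^bsub>R\<^esub> X a \<otimes>\<^bsub>R\<^esub> b}"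

definition commutator :: "('a, 'm) ring_scheme \<Rightarrow> ('a \<Rightarrow> 'a) \<Rightarrow> ('a \<Rightarrow> 'a) \<Rightarrow> 'a \<Rightarrow> 'a" where
  "commutator M f g = (\<lambda>x\<in>carrier M. f (g x) \<ominus>\<^bsub>M\<^esub> g (f x))"

definition derivation_module ::
  "('k, 'a) ring_scheme \<Rightarrow> ('k, 'r, 'm) module_scheme \<Rightarrow> ('r, 'r \<Rightarrow> 'r) module" where
  "derivation_module K R =
     \<lparr>carrier = derivations K R, monoid.mult = undefined, one = undefined,
      ring.zero = (\<lambda>a\<in>carrier R. \<zero>\<^bsub>R\<^esub>),
      ring.add = (\<lambda>X Y. \<lambda>a\<in>carrier R. X a \<oplus>\<^bsub>R\<^esub> Y a),
      smult = (\<lambda>r X. \<lambda>a\<in>carrier R. r \<otimes>\<^bsub>R\<^esub> X a)\<rparr>"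


section \<open>Lie-Rinehart algebras\<close>

locale lie_algebra = K?: field K + V?: module K V
  for K :: "('k, 'a) ring_scheme" and V :: "('k, 'v, 'b) module_scheme" +
  fixes br :: "'v \<Rightarrow> 'v \<Rightarrow> 'v"
  assumes br_closed: "\<lbrakk>x \<in> carrier V; y \<in> carrier V\<rbrakk> \<Longrightarrow> br x y \<in> carrier V"
    and br_add_left: "\<lbrakk>x \<in> carrier V; y \<in> carrier V; z \<in> carrier V\<rbrakk>
      \<Longrightarrow> br (x \<oplus>\<^bsub>V\<^esub> y) z = br x z \<oplus>\<^bsub>V\<^esub> br y z"
    and br_add_right: "\<lbrakk>x \<in> carrier V; y \<in> carrier V; z \<in> carrier V\<rbrakk>
      \<Longrightarrow> br x (y \<oplus>\<^bsub>V\<^esub> z) = br x y \<oplus>\<^bsub>V\<^esub> br x z"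
    and br_smult_left: "\<lbrakk>k \<in> carrier K; x \<in> carrier V; y \<in> carrier V\<rbrakk>
      \<Longrightarrow> br (k \<odot>\<^bsub>V\<^esub> x) y = k \<odot>\<^bsub>V\<^esub> br x y"
    and br_smult_right: "\<lbrakk>k \<in> carrier K; x \<in> carrier V; y \<in> carrier V\<rbrakk>
      \<Longrightarrow> br x (k \<odot>\<^bsub>V\<^esub> y) = k \<odot>\<^bsub>V\<^esub> br x y"
    and br_alternating: "x \<in> carrier V \<Longrightarrow> br x x = \<zero>\<^bsub>V\<^esub>"
    and br_jacobi: "\<lbrakk>x \<in> carrier V; y \<in> carrier V; z \<in> carrier V\<rbrakk>
      \<Longrightarrow> br x (br y z) \<oplus>\<^bsub>V\<^esub> br y (br z x) \<oplus>\<^bsub>V\<^esub> br z (br x y) = \<zero>\<^bsub>V\<^esub>"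

record ('r, 'l) lie_rinehart = "('r, 'l) module" +
  bracket :: "'l \<Rightarrow> 'l \<Rightarrow> 'l"
  anchor :: "'l \<Rightarrow> 'r \<Rightarrow> 'r"

locale lie_rinehart_algebra =
  R?: algebra K R + L?: module R L +
  lie_algebra K "restrict_scalars R L" "bracket L"
  for K :: "('k, 'a) ring_scheme" and R :: "('k, 'r, 'b) module_scheme"
    and L :: "('r, 'l, 'c) lie_rinehart_scheme" +
  assumes anchor_linear: "anchor L \<in> linear_maps R L (derivation_module K R)"
    and anchor_bracket: "\<lbrakk>x \<in> carrier L; y \<in> carrier L\<rbrakk>
      \<Longrightarrow> anchor L (bracket L x y) = commutator R (anchor L x) (anchor L y)"
    and bracket_leibniz: "\<lbrakk>r \<in> carrier R; x \<in> carrier L; y \<in> carrier L\<rbrakk>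
      \<Longrightarrow> bracket L x (r \<odot>\<^bsub>L\<^esub> y) = r \<odot>\<^bsub>L\<^esub> bracket L x y \<oplus>\<^bsub>L\<^esub> anchor L x r \<odot>\<^bsub>L\<^esub> y"

locale transitive_lie_rinehart_algebra = lie_rinehart_algebra +
  assumes anchor_surj: "anchor L ` carrier L = derivations K R"


section \<open>The Lie-Rinehart algebra of derivative endomorphisms of a module\<close>

definition smult_map :: "('r, 'n, 'p) module_scheme \<Rightarrow> 'r \<Rightarrow> 'n \<Rightarrow> 'n" where
  "smult_map N r = (\<lambda>x\<in>carrier N. r \<odot>\<^bsub>N\<^esub> x)"

definition CDO ::
  "('k, 'a) ring_scheme \<Rightarrow> ('k, 'r, 'm) module_scheme \<Rightarrow> ('r, 'n, 'p) module_scheme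
    \<Rightarrow> ('r, ('n \<Rightarrow> 'n) \<times> ('r \<Rightarrow> 'r)) lie_rinehart" where
  "CDO K R N =
     \<lparr>carrier = {(D, X) \<in> endomorphisms K R N \<times> derivations K R.
        \<forall>r\<in>carrier R. commutator N D (smult_map N r) = smult_map N (X r)},
      monoid.mult = undefined, one = undefined,
      ring.zero = (\<lambda>x\<in>carrier N. \<zero>\<^bsub>N\<^esub>, \<lambda>a\<in>carrier R. \<zero>\<^bsub>R\<^esub>),
      ring.add = (\<lambda>(D, X) (E, Y).
        (\<lambda>x\<in>carrier N. D x \<oplus>\<^bsub>N\<^esub> E x, \<lambda>a\<in>carrier R. X a \<oplus>\<^bsub>R\<^esub> Y a)),
      smult = (\<lambda>r (D, X). (\<lambda>x\<in>carrier N. r \<odot>\<^bsub>N\<^esub> D x, \<lambda>a\<in>carrier R. r \<otimes>\<^bsub>R\<^esub> X a)),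
      bracket = (\<lambda>(D, X) (E, Y). (commutator N D E, commutator R X Y)),
      anchor = snd\<rparr>"


section \<open>Projective modules lift against modules on arbitrary types\<close>

definition free_module :: "('r, 'm) ring_scheme \<Rightarrow> 'i set \<Rightarrow> ('r, 'i \<Rightarrow> 'r) module" where
  "free_module R I =
     \<lparr>carrier = {c \<in> I \<rightarrow>\<^sub>E carrier R. finite {i\<in>I. c i \<noteq> \<zero>\<^bsub>R\<^esub>}},
      monoid.mult = undefined, one = undefined, ring.zero = (\<lambda>i\<in>I. \<zero>\<^bsub>R\<^esub>),
      ring.add = (\<lambda>c d. \<lambda>i\<in>I. c i \<oplus>\<^bsub>R\<^esub> d i),
      smult = (\<lambda>r c. \<lambda>i\<in>I. r \<otimes>\<^bsub>R\<^esub> c i)\<rparr>"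

lemma free_module_carrier:
  "c \<in> carrier (free_module R I) \<longleftrightarrow>
     c \<in> extensional I \<and> (\<forall>i\<in>I. c i \<in> carrier R) \<and> finite {i\<in>I. c i \<noteq> \<zero>\<^bsub>R\<^esub>}"
  by (auto simp: free_module_def PiE_iff)

lemma free_module_ops:
  "\<zero>\<^bsub>free_module R I\<^esub> = (\<lambda>i\<in>I. \<zero>\<^bsub>R\<^esub>)"
  "c \<oplus>\<^bsub>free_module R I\<^esub> d = (\<lambda>i\<in>I. c i \<oplus>\<^bsub>R\<^esub> d i)"
  "r \<odot>\<^bsub>free_module R I\<^esub> c = (\<lambda>i\<in>I. r \<otimes>\<^bsub>R\<^esub> c i)"
  by (simp_all add: free_module_def)

lemma module_free_module:
  assumes "cring R" shows "module R (free_module R I)"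
proof -
  interpret cring R by fact
  let ?F = "free_module R I"
  have mem: "(\<lambda>i\<in>I. e i) \<in> carrier ?F"
    if "c \<in> carrier ?F" "d \<in> carrier ?F" "\<And>i. i \<in> I \<Longrightarrow> e i \<in> carrier R"
      "\<And>i. i \<in> I \<Longrightarrow> c i = \<zero>\<^bsub>R\<^esub> \<Longrightarrow> d i = \<zero>\<^bsub>R\<^esub> \<Longrightarrow> e i = \<zero>\<^bsub>R\<^esub>" for c d e
  proof -
    have "finite {i\<in>I. e i \<noteq> \<zero>\<^bsub>R\<^esub>}"
      by (rule finite_subset[of _ "{i\<in>I. c i \<noteq> \<zero>\<^bsub>R\<^esub>} \<union> {i\<in>I. d i \<noteq> \<zero>\<^bsub>R\<^esub>}"])
         (use that in \<open>auto simp: free_module_carrier\<close>)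
    moreover have "{i\<in>I. (\<lambda>i\<in>I. e i) i \<noteq> \<zero>\<^bsub>R\<^esub>} = {i\<in>I. e i \<noteq> \<zero>\<^bsub>R\<^esub>}" by auto
    ultimately show ?thesis using that(3) by (simp add: free_module_carrier)
  qed
  have cl: "c i \<in> carrier R" if "c \<in> carrier ?F" "i \<in> I" for c i
    using that by (simp add: free_module_carrier)
  have ex: "c \<in> extensional I" if "c \<in> carrier ?F" for c
    using that by (simp add: free_module_carrier)
  have ab: "abelian_group ?F"
  proof (rule abelian_groupI, goal_cases)
    case (1 c d) then show ?case
      unfolding free_module_ops by (intro mem[of c d]) (simp_all add: cl)
  next
    case 2 show ?case by (simp add: free_module_ops free_module_carrier cong: conj_cong)
  next
    case (3 c d e) then show ?case
      unfolding free_module_ops by (intro restrict_ext) (simp add: a_assoc cl)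
  next
    case (4 c d) then show ?case
      unfolding free_module_ops by (intro restrict_ext) (simp add: a_comm cl)
  next
    case (5 c) show ?case
      unfolding free_module_ops
      by (rule extensionalityI[OF _ ex[OF 5]]) (simp_all add: cl[OF 5])
  next
    case (6 c)
    have "(\<lambda>i\<in>I. \<ominus>\<^bsub>R\<^esub> c i) \<in> carrier ?F"
      using 6 by (intro mem[of c c]) (simp_all add: cl)
    moreover have "(\<lambda>i\<in>I. \<ominus>\<^bsub>R\<^esub> c i) \<oplus>\<^bsub>?F\<^esub> c = \<zero>\<^bsub>?F\<^esub>"
      unfolding free_module_ops using 6 by (intro restrict_ext) (simp add: l_neg cl)
    ultimately show ?case by blast
  qed
  show ?thesis
  proof (rule moduleI[OF assms ab], goal_cases)
    case (1 r c) then show ?case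
      unfolding free_module_ops by (intro mem[of c c]) (simp_all add: cl)
  next
    case (2 a b c) then show ?case
      unfolding free_module_ops by (intro restrict_ext) (simp add: l_distr cl)
  next
    case (3 a c d) then show ?case
      unfolding free_module_ops by (intro restrict_ext) (simp add: r_distr cl)
  next
    case (4 a b c) then show ?case
      unfolding free_module_ops by (intro restrict_ext) (simp add: m_assoc cl)
  next
    case (5 c) show ?case
      unfolding free_module_ops
      by (rule extensionalityI[OF _ ex[OF 5]]) (simp_all add: cl[OF 5])
  qed
qed

definition lin_comb ::
  "('r, 'm) ring_scheme \<Rightarrow> ('r, 'a, 'p) module_scheme \<Rightarrow> 'i set \<Rightarrow> ('i \<Rightarrow> 'a) \<Rightarrow> ('i \<Rightarrow> 'r) \<Rightarrow> 'a" where
  "lin_comb R A I t c = (\<Oplus>\<^bsub>A\<^esub>i\<in>{i\<in>I. c i \<noteq> \<zero>\<^bsub>R\<^esub>}. c i \<odot>\<^bsub>A\<^esub> t i)"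

lemma lin_comb_superset:
  assumes "module R A" "t \<in> I \<rightarrow> carrier A" "c \<in> I \<rightarrow> carrier R"
    "finite S" "S \<subseteq> I" "\<And>i. i \<in> I \<Longrightarrow> i \<notin> S \<Longrightarrow> c i = \<zero>\<^bsub>R\<^esub>"
  shows "lin_comb R A I t c = (\<Oplus>\<^bsub>A\<^esub>i\<in>S. c i \<odot>\<^bsub>A\<^esub> t i)"
proof -
  interpret module R A by fact
  show ?thesis unfolding lin_comb_def
    by (rule M.add.finprod_mono_neutral_cong_left) (use assms in \<open>auto simp: Pi_def subset_iff\<close>)
qed

lemma lin_comb_linear:
  assumes A: "module R A" and t: "t \<in> I \<rightarrow> carrier A"
  shows "lin_comb R A I t \<in> linear_maps R (free_module R I) A"
proof -
  interpret module R A by fact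
  let ?F = "free_module R I"
  have F: "c \<in> I \<rightarrow> carrier R" "finite {i\<in>I. c i \<noteq> \<zero>\<^bsub>R\<^esub>}" if "c \<in> carrier ?F" for c
    using that by (auto simp: free_module_def)
  interpret F: module R ?F by (rule module_free_module) (rule R.is_cring)
  have 1: "lin_comb R A I t \<in> carrier ?F \<rightarrow> carrier A"
    using t F by (auto simp: lin_comb_def Pi_iff intro!: M.finsum_closed)
  have 2: "lin_comb R A I t (c \<oplus>\<^bsub>?F\<^esub> d) = lin_comb R A I t c \<oplus>\<^bsub>A\<^esub> lin_comb R A I t d"
    if cd: "c \<in> carrier ?F" "d \<in> carrier ?F" for c d
  proof -
    let ?S = "{i\<in>I. c i \<noteq> \<zero>\<^bsub>R\<^esub>} \<union> {i\<in>I. d i \<noteq> \<zero>\<^bsub>R\<^esub>}"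
    have cdF: "c \<oplus>\<^bsub>?F\<^esub> d \<in> carrier ?F" using cd by simp
    have e: "(c \<oplus>\<^bsub>?F\<^esub> d) i = c i \<oplus>\<^bsub>R\<^esub> d i" if "i \<in> I" for i
      using that by (simp add: free_module_def)
    have "lin_comb R A I t (c \<oplus>\<^bsub>?F\<^esub> d) = (\<Oplus>\<^bsub>A\<^esub>i\<in>?S. (c \<oplus>\<^bsub>?F\<^esub> d) i \<odot>\<^bsub>A\<^esub> t i)"
      by (rule lin_comb_superset[OF A t]) (use F[OF cd(1)] F[OF cd(2)] F[OF cdF] e in auto)
    also have "\<dots> = (\<Oplus>\<^bsub>A\<^esub>i\<in>?S. c i \<odot>\<^bsub>A\<^esub> t i \<oplus>\<^bsub>A\<^esub> d i \<odot>\<^bsub>A\<^esub> t i)"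
      by (rule M.finsum_cong') (use t F(1)[OF cd(1)] F(1)[OF cd(2)] in \<open>auto simp: e Pi_iff smult_l_distr\<close>)
    also have "\<dots> = (\<Oplus>\<^bsub>A\<^esub>i\<in>?S. c i \<odot>\<^bsub>A\<^esub> t i) \<oplus>\<^bsub>A\<^esub> (\<Oplus>\<^bsub>A\<^esub>i\<in>?S. d i \<odot>\<^bsub>A\<^esub> t i)"
      by (rule M.finsum_addf) (use t F(1)[OF cd(1)] F(1)[OF cd(2)] in auto)
    also have "(\<Oplus>\<^bsub>A\<^esub>i\<in>?S. c i \<odot>\<^bsub>A\<^esub> t i) = lin_comb R A I t c"
      by (rule lin_comb_superset[OF A t, symmetric]) (use F[OF cd(1)] F[OF cd(2)] in auto)
    also have "(\<Oplus>\<^bsub>A\<^esub>i\<in>?S. d i \<odot>\<^bsub>A\<^esub> t i) = lin_comb R A I t d"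
      by (rule lin_comb_superset[OF A t, symmetric]) (use F[OF cd(1)] F[OF cd(2)] in auto)
    finally show ?thesis .
  qed
  have 3: "lin_comb R A I t (r \<odot>\<^bsub>?F\<^esub> c) = r \<odot>\<^bsub>A\<^esub> lin_comb R A I t c"
    if r: "r \<in> carrier R" and c: "c \<in> carrier ?F" for r c
  proof -
    let ?S = "{i\<in>I. c i \<noteq> \<zero>\<^bsub>R\<^esub>}"
    have e: "(r \<odot>\<^bsub>?F\<^esub> c) i = r \<otimes>\<^bsub>R\<^esub> c i" if "i \<in> I" for i
      using that by (simp add: free_module_def)
    have rcF: "r \<odot>\<^bsub>?F\<^esub> c \<in> carrier ?F" using r c by simp
    have "lin_comb R A I t (r \<odot>\<^bsub>?F\<^esub> c) = (\<Oplus>\<^bsub>A\<^esub>i\<in>?S. (r \<odot>\<^bsub>?F\<^esub> c) i \<odot>\<^bsub>A\<^esub> t i)"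
      by (rule lin_comb_superset[OF A t]) (use F[OF c] F[OF rcF] r e in auto)
    also have "\<dots> = (\<Oplus>\<^bsub>A\<^esub>i\<in>?S. r \<odot>\<^bsub>A\<^esub> (c i \<odot>\<^bsub>A\<^esub> t i))"
      by (rule M.finsum_cong') (use t r F(1)[OF c] in \<open>auto simp: e Pi_iff smult_assoc1\<close>)
    also have "\<dots> = r \<odot>\<^bsub>A\<^esub> lin_comb R A I t c"
      unfolding lin_comb_def
      by (rule finsum_smult_ldistr[symmetric]) (use t r F[OF c] in auto)
    finally show ?thesis .
  qed
  show ?thesis using 1 2 3 by (auto simp: linear_maps_def)
qed

lemma linear_maps_comp:
  "f \<in> linear_maps R A B \<Longrightarrow> g \<in> linear_maps R B C \<Longrightarrow> g \<circ> f \<in> linear_maps R A C"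
  by (auto simp: linear_maps_def Pi_iff)

lemma linear_maps_lin_comb:
  assumes A: "module R A" and B: "module R B" and f: "f \<in> linear_maps R A B"
    and t: "t \<in> I \<rightarrow> carrier A" and c: "c \<in> carrier (free_module R I)"
  shows "f (lin_comb R A I t c) = lin_comb R B I (f \<circ> t) c"
proof -
  interpret A: module R A by fact
  interpret B: module R B by fact
  have z: "f \<zero>\<^bsub>A\<^esub> = \<zero>\<^bsub>B\<^esub>"
  proof -
    have "f (\<zero>\<^bsub>R\<^esub> \<odot>\<^bsub>A\<^esub> \<zero>\<^bsub>A\<^esub>) = \<zero>\<^bsub>R\<^esub> \<odot>\<^bsub>B\<^esub> f \<zero>\<^bsub>A\<^esub>"
      using f unfolding linear_maps_def by blast
    moreover have "f \<zero>\<^bsub>A\<^esub> \<in> carrier B" using f by (auto simp: linear_maps_def)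
    ultimately show ?thesis by simp
  qed
  have "f (\<Oplus>\<^bsub>A\<^esub>i\<in>S. c i \<odot>\<^bsub>A\<^esub> t i) = (\<Oplus>\<^bsub>B\<^esub>i\<in>S. c i \<odot>\<^bsub>B\<^esub> f (t i))"
    if "finite S" "S \<subseteq> I" for S
    using that
  proof (induction S rule: finite_induct)
    case empty then show ?case by (simp add: z)
  next
    case (insert i S)
    have cR: "c \<in> S \<rightarrow> carrier R" "c i \<in> carrier R" "t \<in> S \<rightarrow> carrier A" "t i \<in> carrier A"
      using c t insert.prems by (auto simp: free_module_def)
    have fc: "f x \<in> carrier B" if "x \<in> carrier A" for x using f that by (auto simp: linear_maps_def)
    have fin: "(\<Oplus>\<^bsub>A\<^esub>i\<in>S. c i \<odot>\<^bsub>A\<^esub> t i) \<in> carrier A" using cR by (auto intro!: A.M.finsum_closed)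
    have "f (\<Oplus>\<^bsub>A\<^esub>i\<in>insert i S. c i \<odot>\<^bsub>A\<^esub> t i) = f (c i \<odot>\<^bsub>A\<^esub> t i \<oplus>\<^bsub>A\<^esub> (\<Oplus>\<^bsub>A\<^esub>i\<in>S. c i \<odot>\<^bsub>A\<^esub> t i))"
      using insert cR by (subst A.M.finsum_insert) auto
    also have "\<dots> = c i \<odot>\<^bsub>B\<^esub> f (t i) \<oplus>\<^bsub>B\<^esub> (\<Oplus>\<^bsub>B\<^esub>i\<in>S. c i \<odot>\<^bsub>B\<^esub> f (t i))"
      using f cR fin insert by (auto simp: linear_maps_def)
    also have "\<dots> = (\<Oplus>\<^bsub>B\<^esub>i\<in>insert i S. c i \<odot>\<^bsub>B\<^esub> f (t i))"
      using insert cR fc by (subst B.M.finsum_insert) (auto simp: Pi_iff)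
    finally show ?case .
  qed
  from this[of "{i\<in>I. c i \<noteq> \<zero>\<^bsub>R\<^esub>}"] c show ?thesis
    by (simp add: lin_comb_def free_module_def)
qed

lemma projective_module_section:
  assumes "projective_module R (N :: ('r, 'n) module)"
  obtains s where "s \<in> linear_maps R N (free_module R (carrier N))"
    "\<And>x. x \<in> carrier N \<Longrightarrow> lin_comb R N (carrier N) (\<lambda>x. x) (s x) = x"
proof -
  let ?F = "free_module R (carrier N)" and ?e = "lin_comb R N (carrier N) (\<lambda>x. x)"
  have N: "module R N" using assms by (simp add: projective_module_def)
  interpret module R N by fact
  have F: "module R ?F" by (rule module_free_module) (rule R.is_cring)
  have e: "?e \<in> linear_maps R ?F N" by (rule lin_comb_linear[OF N]) auto
  have surj: "?e ` carrier ?F = carrier N"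
  proof
    show "?e ` carrier ?F \<subseteq> carrier N" using e by (auto simp: linear_maps_def)
    show "carrier N \<subseteq> ?e ` carrier ?F"
    proof
      fix x assume x: "x \<in> carrier N"
      let ?c = "\<lambda>y\<in>carrier N. if y = x then \<one>\<^bsub>R\<^esub> else \<zero>\<^bsub>R\<^esub>"
      have "finite {y \<in> carrier N. ?c y \<noteq> \<zero>\<^bsub>R\<^esub>}" by (rule finite_subset[of _ "{x}"]) auto
      then have c: "?c \<in> carrier ?F" by (auto simp: free_module_def)
      have "?e ?c = (\<Oplus>\<^bsub>N\<^esub>y\<in>{x}. ?c y \<odot>\<^bsub>N\<^esub> y)"
        by (rule lin_comb_superset[OF N]) (use x in auto)
      also have "\<dots> = x" using x by simp
      finally show "x \<in> ?e ` carrier ?F" using c by force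
    qed
  qed
  have "(\<lambda>x. x) \<in> linear_maps R N N" by (auto simp: linear_maps_def)
  with F N e surj assms obtain s where "s \<in> linear_maps R N ?F" "\<forall>x\<in>carrier N. ?e (s x) = x"
    unfolding projective_module_def by blast
  then show ?thesis using that by blast
qed

lemma projective_module_lift:
  assumes N: "projective_module R (N :: ('r, 'n) module)" and A: "module R A" and B: "module R B"
    and f: "f \<in> linear_maps R A B" and surj: "f ` carrier A = carrier B"
    and g: "g \<in> linear_maps R N B"
  shows "\<exists>h\<in>linear_maps R N A. \<forall>x\<in>carrier N. f (h x) = g x"
proof -
  let ?F = "free_module R (carrier N)"
  obtain s where s: "s \<in> linear_maps R N ?F"
    "\<And>x. x \<in> carrier N \<Longrightarrow> lin_comb R N (carrier N) (\<lambda>x. x) (s x) = x"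
    using projective_module_section[OF N] by blast
  have NR: "module R N" using N by (simp add: projective_module_def)
  have "\<forall>x\<in>carrier N. \<exists>a\<in>carrier A. f a = g x"
  proof
    fix x assume "x \<in> carrier N"
    then have "g x \<in> f ` carrier A" using g unfolding surj linear_maps_def by blast
    then show "\<exists>a\<in>carrier A. f a = g x" by (metis imageE)
  qed
  then obtain t where t: "\<And>x. x \<in> carrier N \<Longrightarrow> t x \<in> carrier A" "\<And>x. x \<in> carrier N \<Longrightarrow> f (t x) = g x"
    by metis
  have tA: "t \<in> carrier N \<rightarrow> carrier A" using t by blast
  let ?h = "lin_comb R A (carrier N) t \<circ> s"
  have "?h \<in> linear_maps R N A" by (rule linear_maps_comp[OF s(1) lin_comb_linear[OF A tA]])
  moreover have "f (?h x) = g x" if x: "x \<in> carrier N" for x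
  proof -
    interpret B: module R B by fact
    have sx: "s x \<in> carrier ?F" using s(1) x by (auto simp: linear_maps_def)
    have "f (?h x) = lin_comb R B (carrier N) (f \<circ> t) (s x)"
      using linear_maps_lin_comb[OF A B f tA sx] by simp
    also have "\<dots> = lin_comb R B (carrier N) (g \<circ> (\<lambda>x. x)) (s x)"
    proof -
      have gx: "g y \<in> carrier B" if "y \<in> carrier N" for y
        using g that unfolding linear_maps_def by blast
      have "s x y \<in> carrier R" if "y \<in> carrier N" for y
        using sx that by (simp add: free_module_carrier)
      then show ?thesis unfolding lin_comb_def
        by (intro B.M.finsum_cong') (simp_all add: Pi_iff gx t(2))
    qed
    also have "\<dots> = g (lin_comb R N (carrier N) (\<lambda>x. x) (s x))"
      by (rule linear_maps_lin_comb[OF NR B g _ sx, symmetric]) auto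
    finally show ?thesis using s(2)[OF x] by simp
  qed
  ultimately show ?thesis by blast
qed

end

theory Submission
  imports Defs
begin

text \<open>
  Every derivation \<open>X\<close> of \<open>R\<close> acts on a free module entry by entry, \<open>c \<mapsto> X \<circ> c\<close>. Since \<open>X\<close> is a
  derivation, this action \<open>\<nabla>\<close> satisfies \<open>\<nabla>(rc) = r \<nabla>c + X(r) c\<close>. A projective module \<open>N\<close> is a retract
  of the free module \<open>F\<close> on its elements: the evaluation \<open>e : F \<rightarrow> N\<close> has an \<open>R\<close>-linear section \<open>s\<close>.
  Then \<open>D = e \<circ> \<nabla> \<circ> s\<close> is additive, and \<open>D(rx) = r D(x) + X(r) e(s(x)) = r D(x) + X(r) x\<close>, so
  \<open>(D, X)\<close> is an element of \<open>CDO(N)\<close> over \<open>X\<close> (lemma \<open>projective_module_lift_derivation\<close>). This is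
  the connection that a direct summand inherits from the flat connection of a free module.

  Transitivity presupposes that \<open>CDO(N)\<close> is a Lie-Rinehart algebra, which holds for every module \<open>N\<close>
  (lemma \<open>lie_rinehart_CDO\<close>). Both components of a pair \<open>(D, X)\<close> satisfy the same kind of rule: \<open>D\<close>
  is a Leibniz map of \<open>N\<close> along \<open>X\<close>, and \<open>X\<close> is a Leibniz map along itself of \<open>R\<close>, regarded as a
  module over itself. Hence closure of Leibniz maps under sums, multiples and commutators, and the
  identities between commutators, are proved once for modules and used for both components. The
  \<open>K\<close>-linearity of \<open>D\<close> and \<open>X\<close> amounts to the single condition that \<open>X\<close> kills the scalars \<open>k \<cdot> 1\<close>
  (lemmas \<open>derivations_iff\<close> and \<open>CDO_carrier_iff\<close>).
\<close>


section \<open>Commutators of additive maps\<close>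

definition additive_map :: "('n, 'p) ring_scheme \<Rightarrow> ('n \<Rightarrow> 'n) \<Rightarrow> bool" where
  "additive_map M f \<longleftrightarrow> f \<in> carrier M \<rightarrow> carrier M \<and>
     (\<forall>x\<in>carrier M. \<forall>y\<in>carrier M. f (x \<oplus>\<^bsub>M\<^esub> y) = f x \<oplus>\<^bsub>M\<^esub> f y)"

context abelian_group
begin

lemma minus_eq_iff:
  "x \<in> carrier G \<Longrightarrow> y \<in> carrier G \<Longrightarrow> z \<in> carrier G \<Longrightarrow> x \<ominus> y = z \<longleftrightarrow> x = z \<oplus> y"
  by (metis add.inv_solve_right' a_minus_def)

text \<open>
  The next three lemmas turn an equation between differences into one between sums, which
  commutativity and associativity settle.
\<close>

lemma minus_add_minus:
  "a \<in> carrier G \<Longrightarrow> b \<in> carrier G \<Longrightarrow> c \<in> carrier G \<Longrightarrow> d \<in> carrier G \<Longrightarrow>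
     (a \<ominus> b) \<oplus> (c \<ominus> d) = (a \<oplus> c) \<ominus> (b \<oplus> d)"
  by (simp add: a_minus_def minus_add a_ac)

lemma minus_minus_minus:
  "a \<in> carrier G \<Longrightarrow> b \<in> carrier G \<Longrightarrow> c \<in> carrier G \<Longrightarrow> d \<in> carrier G \<Longrightarrow>
     (a \<ominus> b) \<ominus> (c \<ominus> d) = (a \<oplus> d) \<ominus> (b \<oplus> c)"
  by (simp add: a_minus_def minus_add a_ac)

lemma minus_eq_minus_iff:
  assumes "a \<in> carrier G" "b \<in> carrier G" "c \<in> carrier G" "d \<in> carrier G"
  shows "a \<ominus> b = c \<ominus> d \<longleftrightarrow> a \<oplus> d = c \<oplus> b"
proof -
  have "a \<ominus> b = c \<ominus> d \<longleftrightarrow> a = (c \<ominus> d) \<oplus> b" using assms by (simp add: minus_eq_iff)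
  also have "(c \<ominus> d) \<oplus> b = (c \<oplus> b) \<ominus> d" using assms by (simp add: a_minus_def a_ac)
  also have "a = (c \<oplus> b) \<ominus> d \<longleftrightarrow> a \<oplus> d = c \<oplus> b"
    using minus_eq_iff[of "c \<oplus> b" d a] assms by auto
  finally show ?thesis .
qed

lemma additive_map_closed: "additive_map G f \<Longrightarrow> x \<in> carrier G \<Longrightarrow> f x \<in> carrier G"
  by (auto simp: additive_map_def)

lemma additive_map_add:
  "additive_map G f \<Longrightarrow> x \<in> carrier G \<Longrightarrow> y \<in> carrier G \<Longrightarrow> f (x \<oplus> y) = f x \<oplus> f y"
  by (auto simp: additive_map_def)

lemma additive_map_zero: "additive_map G f \<Longrightarrow> f \<zero> = \<zero>"
  by (metis add.l_cancel_one' additive_map_add additive_map_closed l_zero zero_closed)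

lemma additive_map_minus:
  assumes "additive_map G f" "x \<in> carrier G" "y \<in> carrier G"
  shows "f (x \<ominus> y) = f x \<ominus> f y"
proof -
  have "f (\<ominus> y) \<oplus> f y = \<zero>"
    using assms additive_map_add[of f "\<ominus> y" y] by (simp add: l_neg additive_map_zero)
  then have "f (\<ominus> y) = \<ominus> f y"
    using assms by (metis a_inv_closed additive_map_closed minus_equality)
  then show ?thesis using assms by (simp add: a_minus_def additive_map_add)
qed

lemma additive_map_plus:
  assumes "additive_map G f" "additive_map G g"
  shows "additive_map G (\<lambda>x\<in>carrier G. f x \<oplus> g x)"
  using assms by (auto simp: additive_map_def Pi_iff a_ac)

lemma additive_map_commutator:
  assumes f: "additive_map G f" and g: "additive_map G g"
  shows "additive_map G (commutator G f g)"
  unfolding additive_map_def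
proof (intro conjI ballI)
  show "commutator G f g \<in> carrier G \<rightarrow> carrier G"
    using assms by (auto simp: commutator_def additive_map_closed)
  fix x y assume "x \<in> carrier G" "y \<in> carrier G"
  then show "commutator G f g (x \<oplus> y) = commutator G f g x \<oplus> commutator G f g y"
    using assms by (simp add: commutator_def a_minus_def additive_map_closed additive_map_add minus_add a_ac)
qed

lemma commutator_self: "additive_map G f \<Longrightarrow> commutator G f f = (\<lambda>x\<in>carrier G. \<zero>)"
  by (auto simp: commutator_def a_minus_def additive_map_closed r_neg intro!: restrict_ext)

lemma commutator_add_left:
  assumes "additive_map G f" "additive_map G f'" "additive_map G g"
  shows "commutator G (\<lambda>x\<in>carrier G. f x \<oplus> f' x) g =
    (\<lambda>x\<in>carrier G. commutator G f g x \<oplus> commutator G f' g x)"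
  using assms
  by (auto simp: commutator_def a_minus_def additive_map_closed additive_map_add minus_add a_ac
      intro!: restrict_ext)

lemma commutator_add_right:
  assumes "additive_map G f" "additive_map G g" "additive_map G g'"
  shows "commutator G f (\<lambda>x\<in>carrier G. g x \<oplus> g' x) =
    (\<lambda>x\<in>carrier G. commutator G f g x \<oplus> commutator G f g' x)"
  using assms
  by (auto simp: commutator_def a_minus_def additive_map_closed additive_map_add minus_add a_ac
      intro!: restrict_ext)

lemma commutator_jacobi:
  assumes "additive_map G f" "additive_map G g" "additive_map G h"
  shows "(\<lambda>x\<in>carrier G. (commutator G f (commutator G g h) x
      \<oplus> commutator G g (commutator G h f) x) \<oplus> commutator G h (commutator G f g) x)
    = (\<lambda>x\<in>carrier G. \<zero>)"
proof (rule restrict_ext)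
  fix x assume x: "x \<in> carrier G"
  \<comment> \<open>The letters are the six composites: \<open>a = fgh\<close>, \<open>b = fhg\<close>, \<open>c = ghf\<close>, \<open>d = hgf\<close>, \<open>e = gfh\<close>,
    \<open>p = hfg\<close>. Each occurs once with either sign.\<close>
  have *: "((a \<ominus> b \<ominus> (c \<ominus> d)) \<oplus> (c \<ominus> e \<ominus> (p \<ominus> b))) \<oplus> (p \<ominus> d \<ominus> (a \<ominus> e)) = \<zero>"
    if "a \<in> carrier G" "b \<in> carrier G" "c \<in> carrier G"
      "d \<in> carrier G" "e \<in> carrier G" "p \<in> carrier G" for a b c d e p
    using that by (simp add: minus_add_minus minus_minus_minus minus_eq_iff a_ac)
  show "(commutator G f (commutator G g h) x
      \<oplus> commutator G g (commutator G h f) x) \<oplus> commutator G h (commutator G f g) x = \<zero>"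
    using assms x
    by (simp add: commutator_def additive_map_closed additive_map_minus *)
qed

end


section \<open>Leibniz maps\<close>

text \<open>
  In geometric terms \<open>D\<close> is a first-order differential operator with scalar symbol \<open>X\<close>. Allowing
  an arbitrary map \<open>X\<close> makes it possible to express by the same predicate, with \<open>D = X\<close>, that \<open>X\<close>
  satisfies the product rule.
\<close>

definition leibniz_map ::
  "('r, 'm) ring_scheme \<Rightarrow> ('r, 'n, 'p) module_scheme \<Rightarrow> ('r \<Rightarrow> 'r) \<Rightarrow> ('n \<Rightarrow> 'n) \<Rightarrow> bool" where
  "leibniz_map R M X D \<longleftrightarrow> D \<in> extensional (carrier M) \<and> additive_map M D \<and>
     (\<forall>r\<in>carrier R. \<forall>x\<in>carrier M. D (r \<odot>\<^bsub>M\<^esub> x) = r \<odot>\<^bsub>M\<^esub> D x \<oplus>\<^bsub>M\<^esub> X r \<odot>\<^bsub>M\<^esub> x)"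

lemma leibniz_map_additive: "leibniz_map R M X D \<Longrightarrow> additive_map M D"
  by (simp add: leibniz_map_def)

lemma leibniz_map_extensional: "leibniz_map R M X D \<Longrightarrow> D \<in> extensional (carrier M)"
  by (simp add: leibniz_map_def)

lemma leibniz_map_smult:
  "leibniz_map R M X D \<Longrightarrow> r \<in> carrier R \<Longrightarrow> x \<in> carrier M \<Longrightarrow>
     D (r \<odot>\<^bsub>M\<^esub> x) = r \<odot>\<^bsub>M\<^esub> D x \<oplus>\<^bsub>M\<^esub> X r \<odot>\<^bsub>M\<^esub> x"
  by (simp add: leibniz_map_def)

context module
begin

lemma leibniz_map_closed: "leibniz_map R M X D \<Longrightarrow> x \<in> carrier M \<Longrightarrow> D x \<in> carrier M"
  by (auto simp: leibniz_map_def additive_map_def)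

lemma leibniz_map_zero:
  "leibniz_map R M (\<lambda>a\<in>carrier R. \<zero>\<^bsub>R\<^esub>) (\<lambda>x\<in>carrier M. \<zero>\<^bsub>M\<^esub>)"
  by (auto simp: leibniz_map_def additive_map_def)

lemma leibniz_map_plus:
  assumes D: "leibniz_map R M X D" and E: "leibniz_map R M Y E"
    and X: "X \<in> carrier R \<rightarrow> carrier R" and Y: "Y \<in> carrier R \<rightarrow> carrier R"
  shows "leibniz_map R M (\<lambda>a\<in>carrier R. X a \<oplus>\<^bsub>R\<^esub> Y a) (\<lambda>x\<in>carrier M. D x \<oplus>\<^bsub>M\<^esub> E x)"
proof -
  note [simp] = leibniz_map_closed[OF D] leibniz_map_closed[OF E]
    leibniz_map_smult[OF D] leibniz_map_smult[OF E] funcset_mem[OF X] funcset_mem[OF Y]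
  show ?thesis
    using M.additive_map_plus[OF D[THEN leibniz_map_additive] E[THEN leibniz_map_additive]]
    by (auto simp: leibniz_map_def smult_l_distr smult_r_distr M.a_ac)
qed

lemma leibniz_map_scale:
  assumes D: "leibniz_map R M X D" and X: "X \<in> carrier R \<rightarrow> carrier R" and r: "r \<in> carrier R"
  shows "leibniz_map R M (\<lambda>a\<in>carrier R. r \<otimes>\<^bsub>R\<^esub> X a) (\<lambda>x\<in>carrier M. r \<odot>\<^bsub>M\<^esub> D x)"
proof -
  note [simp] = leibniz_map_closed[OF D] leibniz_map_smult[OF D] funcset_mem[OF X] r
    M.additive_map_add[OF D[THEN leibniz_map_additive]]
  have "r \<odot>\<^bsub>M\<^esub> (s \<odot>\<^bsub>M\<^esub> y) = s \<odot>\<^bsub>M\<^esub> (r \<odot>\<^bsub>M\<^esub> y)" if "s \<in> carrier R" "y \<in> carrier M" for s y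
    using that by (metis R.m_comm r smult_assoc1)
  then show ?thesis
    by (auto simp: leibniz_map_def additive_map_def smult_assoc1 smult_r_distr)
qed

text \<open>
  In \<open>D(E(rx)) - E(D(rx))\<close> the mixed terms \<open>X(r) E(x)\<close> and \<open>Y(r) D(x)\<close> occur in both halves and
  cancel; what remains besides \<open>r [D, E](x)\<close> is \<open>(X(Y(r)) - Y(X(r))) x\<close>.
\<close>

lemma leibniz_map_commutator:
  assumes D: "leibniz_map R M X D" and E: "leibniz_map R M Y E"
    and X: "X \<in> carrier R \<rightarrow> carrier R" and Y: "Y \<in> carrier R \<rightarrow> carrier R"
  shows "leibniz_map R M (commutator R X Y) (commutator M D E)"
proof -
  note add = D[THEN leibniz_map_additive] E[THEN leibniz_map_additive]
  note [simp] = leibniz_map_closed[OF D] leibniz_map_closed[OF E]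
    leibniz_map_smult[OF D] leibniz_map_smult[OF E] funcset_mem[OF X] funcset_mem[OF Y]
    M.additive_map_add[OF add(1)] M.additive_map_add[OF add(2)]
  have "commutator M D E (r \<odot>\<^bsub>M\<^esub> x)
      = r \<odot>\<^bsub>M\<^esub> commutator M D E x \<oplus>\<^bsub>M\<^esub> commutator R X Y r \<odot>\<^bsub>M\<^esub> x"
    if "r \<in> carrier R" "x \<in> carrier M" for r x
  proof -
    have *: "(a \<oplus>\<^bsub>M\<^esub> b \<oplus>\<^bsub>M\<^esub> (c \<oplus>\<^bsub>M\<^esub> d)) \<ominus>\<^bsub>M\<^esub> (e \<oplus>\<^bsub>M\<^esub> c \<oplus>\<^bsub>M\<^esub> (b \<oplus>\<^bsub>M\<^esub> f))
        = (a \<ominus>\<^bsub>M\<^esub> e) \<oplus>\<^bsub>M\<^esub> (d \<ominus>\<^bsub>M\<^esub> f)"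
      if "a \<in> carrier M" "b \<in> carrier M" "c \<in> carrier M" "d \<in> carrier M"
        "e \<in> carrier M" "f \<in> carrier M" for a b c d e f
      using that by (simp add: M.minus_add_minus M.minus_eq_minus_iff M.a_ac)
    have "commutator M D E (r \<odot>\<^bsub>M\<^esub> x)
      = (r \<odot>\<^bsub>M\<^esub> D (E x) \<ominus>\<^bsub>M\<^esub> r \<odot>\<^bsub>M\<^esub> E (D x)) \<oplus>\<^bsub>M\<^esub> (X (Y r) \<odot>\<^bsub>M\<^esub> x \<ominus>\<^bsub>M\<^esub> Y (X r) \<odot>\<^bsub>M\<^esub> x)"
      using that by (simp add: commutator_def *)
    then show ?thesis
      using that by (simp add: commutator_def a_minus_def smult_r_distr smult_l_distr
        smult_l_minus smult_r_minus)
  qed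
  moreover have "commutator M D E \<in> extensional (carrier M)" by (simp add: commutator_def)
  ultimately show ?thesis using M.additive_map_commutator[OF add] by (simp add: leibniz_map_def)
qed

text \<open>
  This is the Leibniz rule of the anchor. For \<open>X r = 0\<close> it says that scalars can be pulled out of the
  second argument of the commutator.
\<close>

lemma commutator_scale_right:
  assumes D: "leibniz_map R M X D" and E: "additive_map M E" and X: "X \<in> carrier R \<rightarrow> carrier R"
    and r: "r \<in> carrier R"
  shows "commutator M D (\<lambda>x\<in>carrier M. r \<odot>\<^bsub>M\<^esub> E x)
    = (\<lambda>x\<in>carrier M. r \<odot>\<^bsub>M\<^esub> commutator M D E x \<oplus>\<^bsub>M\<^esub> X r \<odot>\<^bsub>M\<^esub> E x)"
proof -
  note [simp] = leibniz_map_closed[OF D] leibniz_map_smult[OF D] funcset_mem[OF X] r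
    M.additive_map_closed[OF E]
  show ?thesis
    by (auto simp: commutator_def a_minus_def smult_r_distr smult_r_minus M.a_ac
        intro!: restrict_ext)
qed

lemma commutator_scale_left:
  assumes D: "leibniz_map R M X D" and E: "leibniz_map R M Y E"
    and r: "r \<in> carrier R" "Y r = \<zero>\<^bsub>R\<^esub>"
  shows "commutator M (\<lambda>x\<in>carrier M. r \<odot>\<^bsub>M\<^esub> D x) E
    = (\<lambda>x\<in>carrier M. r \<odot>\<^bsub>M\<^esub> commutator M D E x)"
proof -
  note [simp] = leibniz_map_closed[OF D] leibniz_map_closed[OF E] leibniz_map_smult[OF E] r
  show ?thesis
    by (auto simp: commutator_def a_minus_def smult_r_distr smult_r_minus intro!: restrict_ext)
qed

lemma commutator_smult_map_iff:
  assumes D: "additive_map M D" and X: "X \<in> carrier R \<rightarrow> carrier R" and r: "r \<in> carrier R"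
  shows "commutator M D (smult_map M r) = smult_map M (X r) \<longleftrightarrow>
    (\<forall>x\<in>carrier M. D (r \<odot>\<^bsub>M\<^esub> x) = r \<odot>\<^bsub>M\<^esub> D x \<oplus>\<^bsub>M\<^esub> X r \<odot>\<^bsub>M\<^esub> x)"
proof -
  show ?thesis
    unfolding commutator_def smult_map_def
    by (simp add: restrict_def fun_eq_iff M.minus_eq_iff M.additive_map_closed[OF D] funcset_mem[OF X] r)
       (auto simp: M.a_comm M.additive_map_closed[OF D] funcset_mem[OF X] r M.minus_eq_iff)
qed

end


section \<open>Derivations\<close>

text \<open>
  The ring as a module over itself. An algebra \<open>R\<close> over \<open>K\<close> carries the scalar multiplication of \<open>K\<close>
  in its record, so multiplication by ring elements needs a record of its own.
\<close>

definition regular_module :: "('r, 'm) ring_scheme \<Rightarrow> ('r, 'r) module" where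
  "regular_module R =
     \<lparr>carrier = carrier R, monoid.mult = monoid.mult R, one = one R,
      ring.zero = ring.zero R, ring.add = ring.add R, smult = monoid.mult R\<rparr>"

lemma regular_module_simps [simp]:
  "carrier (regular_module R) = carrier R"
  "\<zero>\<^bsub>regular_module R\<^esub> = \<zero>\<^bsub>R\<^esub>"
  "x \<oplus>\<^bsub>regular_module R\<^esub> y = x \<oplus>\<^bsub>R\<^esub> y"
  "x \<odot>\<^bsub>regular_module R\<^esub> y = x \<otimes>\<^bsub>R\<^esub> y"
  by (simp_all add: regular_module_def)

lemma commutator_regular_module [simp]: "commutator (regular_module R) = commutator R"
  by (simp add: fun_eq_iff commutator_def regular_module_def a_minus_def a_inv_def m_inv_def)

lemma additive_map_regular_module [simp]: "additive_map (regular_module R) = additive_map R"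
  by (simp add: fun_eq_iff additive_map_def)

lemma module_regular_module:
  assumes "cring R" shows "module R (regular_module R)"
proof -
  interpret cring R by fact
  have "abelian_group (regular_module R)"
    by (rule abelian_groupI) (auto simp: a_ac intro: l_neg)
  then show ?thesis
    by (intro moduleI assms) (auto simp: l_distr r_distr m_assoc)
qed

context algebra
begin

lemma smult_eq_mult: "k \<in> carrier R \<Longrightarrow> a \<in> carrier M \<Longrightarrow> k \<odot>\<^bsub>M\<^esub> a = (k \<odot>\<^bsub>M\<^esub> \<one>\<^bsub>M\<^esub>) \<otimes>\<^bsub>M\<^esub> a"
  by (simp add: smult_assoc2)

text \<open>
  A derivation vanishes at \<open>1\<close>, and hence at \<open>k \<cdot> 1\<close> by linearity. Conversely \<open>k \<cdot> a = (k \<cdot> 1) a\<close>, so by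
  the product rule a derivation that vanishes at all \<open>k \<cdot> 1\<close> is linear.
\<close>

lemma derivations_iff:
  "X \<in> derivations R M \<longleftrightarrow> leibniz_map M (regular_module M) X X \<and>
     (\<forall>k\<in>carrier R. X (k \<odot>\<^bsub>M\<^esub> \<one>\<^bsub>M\<^esub>) = \<zero>\<^bsub>M\<^esub>)"
proof
  assume X: "X \<in> derivations R M"
  then have add: "additive_map M X" by (auto simp: derivations_def linear_maps_def additive_map_def)
  have leib: "X (a \<otimes>\<^bsub>M\<^esub> b) = a \<otimes>\<^bsub>M\<^esub> X b \<oplus>\<^bsub>M\<^esub> X a \<otimes>\<^bsub>M\<^esub> b"
    if "a \<in> carrier M" "b \<in> carrier M" for a b
    using X that by (auto simp: derivations_def)
  have lin: "X (k \<odot>\<^bsub>M\<^esub> a) = k \<odot>\<^bsub>M\<^esub> X a" if "k \<in> carrier R" "a \<in> carrier M" for k a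
    using X that by (auto simp: derivations_def linear_maps_def)
  have cl: "X a \<in> carrier M" if "a \<in> carrier M" for a
    using X that by (auto simp: derivations_def linear_maps_def)
  have "X \<one>\<^bsub>M\<^esub> = X \<one>\<^bsub>M\<^esub> \<oplus>\<^bsub>M\<^esub> X \<one>\<^bsub>M\<^esub>" using leib[of "\<one>\<^bsub>M\<^esub>" "\<one>\<^bsub>M\<^esub>"] cl[of "\<one>\<^bsub>M\<^esub>"] by simp
  then have "X \<one>\<^bsub>M\<^esub> = \<zero>\<^bsub>M\<^esub>" using cl[OF one_closed] by (metis M.add.l_cancel_one')
  then show "leibniz_map M (regular_module M) X X \<and>
     (\<forall>k\<in>carrier R. X (k \<odot>\<^bsub>M\<^esub> \<one>\<^bsub>M\<^esub>) = \<zero>\<^bsub>M\<^esub>)"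
    using X add leib lin by (simp add: leibniz_map_def derivations_def)
next
  assume X: "leibniz_map M (regular_module M) X X \<and> (\<forall>k\<in>carrier R. X (k \<odot>\<^bsub>M\<^esub> \<one>\<^bsub>M\<^esub>) = \<zero>\<^bsub>M\<^esub>)"
  then have cl: "X a \<in> carrier M" if "a \<in> carrier M" for a
    using that by (auto simp: leibniz_map_def additive_map_def)
  have "X (k \<odot>\<^bsub>M\<^esub> a) = k \<odot>\<^bsub>M\<^esub> X a" if "k \<in> carrier R" "a \<in> carrier M" for k a
  proof -
    have "X (k \<odot>\<^bsub>M\<^esub> a) = X ((k \<odot>\<^bsub>M\<^esub> \<one>\<^bsub>M\<^esub>) \<otimes>\<^bsub>M\<^esub> a)"
      using smult_eq_mult[OF that] by simp
    also have "\<dots> = (k \<odot>\<^bsub>M\<^esub> \<one>\<^bsub>M\<^esub>) \<otimes>\<^bsub>M\<^esub> X a"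
      using X that cl[of a] leibniz_map_smult[of M "regular_module M" X X "k \<odot>\<^bsub>M\<^esub> \<one>\<^bsub>M\<^esub>" a] by simp
    finally show ?thesis using smult_eq_mult[OF that(1) cl[OF that(2)]] by simp
  qed
  then show "X \<in> derivations R M"
    using X by (auto simp: derivations_def linear_maps_def leibniz_map_def additive_map_def)
qed

lemma derivation_leibniz_map: "X \<in> derivations R M \<Longrightarrow> leibniz_map M (regular_module M) X X"
  by (simp add: derivations_iff)

lemma derivation_scalar: "X \<in> derivations R M \<Longrightarrow> k \<in> carrier R \<Longrightarrow> X (k \<odot>\<^bsub>M\<^esub> \<one>\<^bsub>M\<^esub>) = \<zero>\<^bsub>M\<^esub>"
  by (simp add: derivations_iff)

lemma derivation_additive: "X \<in> derivations R M \<Longrightarrow> additive_map M X"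
  using leibniz_map_additive[OF derivation_leibniz_map] by simp

lemma derivation_closed: "X \<in> derivations R M \<Longrightarrow> X \<in> carrier M \<rightarrow> carrier M"
  by (auto dest!: derivation_additive simp: additive_map_def)

lemma derivation_zero: "X \<in> derivations R M \<Longrightarrow> X \<zero>\<^bsub>M\<^esub> = \<zero>\<^bsub>M\<^esub>"
  by (rule additive_map_zero[OF derivation_additive])

lemma derivations_closed:
  shows derivations_zero: "(\<lambda>a\<in>carrier M. \<zero>\<^bsub>M\<^esub>) \<in> derivations R M"
    and derivations_plus: "X \<in> derivations R M \<Longrightarrow> Y \<in> derivations R M \<Longrightarrow>
      (\<lambda>a\<in>carrier M. X a \<oplus>\<^bsub>M\<^esub> Y a) \<in> derivations R M"
    and derivations_scale: "r \<in> carrier M \<Longrightarrow> X \<in> derivations R M \<Longrightarrow>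
      (\<lambda>a\<in>carrier M. r \<otimes>\<^bsub>M\<^esub> X a) \<in> derivations R M"
    and derivations_commutator: "X \<in> derivations R M \<Longrightarrow> Y \<in> derivations R M \<Longrightarrow>
      commutator M X Y \<in> derivations R M"
proof -
  interpret self: module M "regular_module M" by (rule module_regular_module[OF M_cring])
  show "(\<lambda>a\<in>carrier M. \<zero>\<^bsub>M\<^esub>) \<in> derivations R M"
    using self.leibniz_map_zero by (simp add: derivations_iff)
  show "(\<lambda>a\<in>carrier M. X a \<oplus>\<^bsub>M\<^esub> Y a) \<in> derivations R M"
    if X: "X \<in> derivations R M" and Y: "Y \<in> derivations R M"
    unfolding derivations_iff
    using self.leibniz_map_plus[OF derivation_leibniz_map[OF X]
      derivation_leibniz_map[OF Y] derivation_closed[OF X] derivation_closed[OF Y]]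
    by (simp add: derivation_scalar[OF X] derivation_scalar[OF Y])
  show "(\<lambda>a\<in>carrier M. r \<otimes>\<^bsub>M\<^esub> X a) \<in> derivations R M"
    if r: "r \<in> carrier M" and X: "X \<in> derivations R M"
    unfolding derivations_iff
    using self.leibniz_map_scale[OF derivation_leibniz_map[OF X] derivation_closed[OF X] r] r
    by (simp add: derivation_scalar[OF X])
  show "commutator M X Y \<in> derivations R M"
    if X: "X \<in> derivations R M" and Y: "Y \<in> derivations R M"
    unfolding derivations_iff
    using self.leibniz_map_commutator[OF derivation_leibniz_map[OF X]
      derivation_leibniz_map[OF Y] derivation_closed[OF X] derivation_closed[OF Y]]
    by (simp add: derivation_scalar[OF X] derivation_scalar[OF Y] derivation_zero[OF X]
        derivation_zero[OF Y] commutator_def a_minus_def)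
qed

text \<open>The reason is that \<open>k \<mapsto> k \<cdot> 1\<close> is a ring homomorphism.\<close>

lemma module_restrict_scalars:
  assumes "module M N" shows "module R (restrict_scalars M N)"
proof -
  interpret N: module M N by fact
  have "abelian_group (restrict_scalars M N)"
    by (rule abelian_groupI) (auto simp: restrict_scalars_def N.M.a_ac intro: N.M.l_neg)
  moreover have "((a \<otimes>\<^bsub>R\<^esub> b) \<odot>\<^bsub>M\<^esub> \<one>\<^bsub>M\<^esub>) = (a \<odot>\<^bsub>M\<^esub> \<one>\<^bsub>M\<^esub>) \<otimes>\<^bsub>M\<^esub> (b \<odot>\<^bsub>M\<^esub> \<one>\<^bsub>M\<^esub>)"
    if "a \<in> carrier R" "b \<in> carrier R" for a b
    using that by (simp add: smult_assoc1 smult_assoc2)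
  ultimately show ?thesis
    by (intro moduleI R_cring)
       (auto simp: restrict_scalars_def smult_l_distr N.smult_l_distr N.smult_r_distr
          N.smult_assoc1)
qed

end


section \<open>The Lie-Rinehart algebra of derivative endomorphisms\<close>

lemma restrict_scalars_simps [simp]:
  "carrier (restrict_scalars R L) = carrier L"
  "\<zero>\<^bsub>restrict_scalars R L\<^esub> = \<zero>\<^bsub>L\<^esub>"
  "x \<oplus>\<^bsub>restrict_scalars R L\<^esub> y = x \<oplus>\<^bsub>L\<^esub> y"
  "k \<odot>\<^bsub>restrict_scalars R L\<^esub> x = (k \<odot>\<^bsub>R\<^esub> \<one>\<^bsub>R\<^esub>) \<odot>\<^bsub>L\<^esub> x"
  by (simp_all add: restrict_scalars_def)

lemma CDO_simps:
  "\<zero>\<^bsub>CDO K R N\<^esub> = (\<lambda>x\<in>carrier N. \<zero>\<^bsub>N\<^esub>, \<lambda>a\<in>carrier R. \<zero>\<^bsub>R\<^esub>)"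
  "(D, X) \<oplus>\<^bsub>CDO K R N\<^esub> (E, Y) =
     (\<lambda>x\<in>carrier N. D x \<oplus>\<^bsub>N\<^esub> E x, \<lambda>a\<in>carrier R. X a \<oplus>\<^bsub>R\<^esub> Y a)"
  "r \<odot>\<^bsub>CDO K R N\<^esub> (D, X) = (\<lambda>x\<in>carrier N. r \<odot>\<^bsub>N\<^esub> D x, \<lambda>a\<in>carrier R. r \<otimes>\<^bsub>R\<^esub> X a)"
  "bracket (CDO K R N) (D, X) (E, Y) = (commutator N D E, commutator R X Y)"
  "anchor (CDO K R N) (D, X) = X"
  by (simp_all add: CDO_def)

locale algebra_module = N?: module R N + A: algebra K R
  for K :: "('k, 'a) ring_scheme" and R :: "('k, 'r, 'b) module_scheme"
    and N :: "('r, 'n, 'c) module_scheme"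
begin

text \<open>
  The \<open>K\<close>-linearity of \<open>D\<close> is absent on the right because it follows from the Leibniz rule:
  \<open>D((k \<cdot> 1) x) = (k \<cdot> 1) D(x) + X(k \<cdot> 1) x\<close>, where \<open>X(k \<cdot> 1) = 0\<close>.
\<close>

lemma CDO_carrier_iff:
  "(D, X) \<in> carrier (CDO K R N) \<longleftrightarrow> X \<in> derivations K R \<and> leibniz_map R N X D"
proof (cases "X \<in> derivations K R \<and> additive_map N D \<and> D \<in> extensional (carrier N)")
  case True
  then have X: "X \<in> derivations K R" and D: "additive_map N D" by auto
  have "D ((k \<odot>\<^bsub>R\<^esub> \<one>\<^bsub>R\<^esub>) \<odot>\<^bsub>N\<^esub> x) = (k \<odot>\<^bsub>R\<^esub> \<one>\<^bsub>R\<^esub>) \<odot>\<^bsub>N\<^esub> D x"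
    if "leibniz_map R N X D" "k \<in> carrier K" "x \<in> carrier N" for k x
    using that leibniz_map_smult[OF that(1), of "k \<odot>\<^bsub>R\<^esub> \<one>\<^bsub>R\<^esub>" x]
    by (simp add: A.derivation_scalar[OF X] N.leibniz_map_closed)
  with True show ?thesis
    using N.commutator_smult_map_iff[OF D A.derivation_closed[OF X]]
    by (auto simp: CDO_def endomorphisms_def linear_maps_def leibniz_map_def additive_map_def)
next
  case False
  then show ?thesis
    by (auto simp: CDO_def endomorphisms_def linear_maps_def leibniz_map_def additive_map_def)
qed

lemma CDO_cases:
  assumes "z \<in> carrier (CDO K R N)"
  obtains D X where "z = (D, X)" "X \<in> derivations K R" "leibniz_map R N X D"
  using assms CDO_carrier_iff by (cases z) auto

lemma module_CDO: "module R (CDO K R N)"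
proof -
  let ?C = "CDO K R N"
  have clX: "X a \<in> carrier R" if "X \<in> derivations K R" "a \<in> carrier R" for X a
    using A.derivation_closed that by blast
  have extX: "X \<in> extensional (carrier R)" if "X \<in> derivations K R" for X
    using that by (simp add: derivations_def)
  note cl = clX N.leibniz_map_closed
  have add: "z \<oplus>\<^bsub>?C\<^esub> w \<in> carrier ?C" if "z \<in> carrier ?C" "w \<in> carrier ?C" for z w
    using that by (auto elim!: CDO_cases simp: CDO_simps CDO_carrier_iff
      intro!: A.derivations_plus N.leibniz_map_plus A.derivation_closed)
  have scale: "r \<odot>\<^bsub>?C\<^esub> z \<in> carrier ?C" if "r \<in> carrier R" "z \<in> carrier ?C" for r z
    using that by (auto elim!: CDO_cases simp: CDO_simps CDO_carrier_iff
      intro!: A.derivations_scale N.leibniz_map_scale A.derivation_closed)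
  have ext: "(\<lambda>x\<in>carrier N. D x) = D" "(\<lambda>a\<in>carrier R. X a) = X"
    if "X \<in> derivations K R" "leibniz_map R N X D" for D X
    using extensional_restrict[OF leibniz_map_extensional[OF that(2)]]
      extensional_restrict[OF extX[OF that(1)]] by simp_all
  have abel: "abelian_group ?C"
  proof (rule abelian_groupI, goal_cases)
    case (1 z w) then show ?case by (rule add)
  next
    case 2 show ?case by (simp add: CDO_simps CDO_carrier_iff A.derivations_zero N.leibniz_map_zero)
  next
    case (3 x y z) then show ?case
      by (auto elim!: CDO_cases simp: CDO_simps cl R.a_assoc N.M.a_assoc intro!: restrict_ext)
  next
    case (4 x y) then show ?case
      by (auto elim!: CDO_cases simp: CDO_simps cl R.a_comm N.M.a_comm intro!: restrict_ext)
  next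
    case (5 x) then show ?case
      by (auto elim!: CDO_cases simp: CDO_simps cl ext cong: restrict_cong)
  next
    case (6 x)
    have "(\<ominus>\<^bsub>R\<^esub> \<one>\<^bsub>R\<^esub>) \<odot>\<^bsub>?C\<^esub> x \<oplus>\<^bsub>?C\<^esub> x = \<zero>\<^bsub>?C\<^esub>"
      using 6 by (auto elim!: CDO_cases simp: CDO_simps cl N.smult_l_minus R.l_minus R.l_neg
        N.M.l_neg intro!: restrict_ext)
    then show ?case using scale[OF _ 6] by force
  qed
  show ?thesis
  proof (rule moduleI[OF R.is_cring abel], goal_cases)
    case (1 a x) then show ?case by (rule scale)
  next
    case (2 a b x) then show ?case
      by (auto elim!: CDO_cases simp: CDO_simps cl R.l_distr N.smult_l_distr intro!: restrict_ext)
  next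
    case (3 a x y) then show ?case
      by (auto elim!: CDO_cases simp: CDO_simps cl R.r_distr N.smult_r_distr intro!: restrict_ext)
  next
    case (4 a b x) then show ?case
      by (auto elim!: CDO_cases simp: CDO_simps cl R.m_assoc N.smult_assoc1 intro!: restrict_ext)
  next
    case (5 x) then show ?case
      by (auto elim!: CDO_cases simp: CDO_simps cl ext cong: restrict_cong)
  qed
qed

text \<open>
  All identities are checked in each component. Homogeneity over \<open>K\<close> needs no computation of its own:
  in either argument it is the behaviour of the bracket under multiplication by \<open>r \<in> R\<close>, taken at
  \<open>r = k \<cdot> 1\<close>, where all anchors vanish.
\<close>

lemma lie_rinehart_CDO:
  assumes "field K"
  shows "lie_rinehart_algebra K R (CDO K R N)"
proof -
  let ?C = "CDO K R N"
  interpret C: module R ?C by (rule module_CDO)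
  interpret self: module R "regular_module R" by (rule module_regular_module[OF R.is_cring])
  note der = A.derivation_leibniz_map A.derivation_additive A.derivation_closed A.derivation_scalar
  have br_closed: "bracket ?C x y \<in> carrier ?C" if "x \<in> carrier ?C" "y \<in> carrier ?C" for x y
    using that by (auto elim!: CDO_cases simp: CDO_simps CDO_carrier_iff
      intro!: A.derivations_commutator N.leibniz_map_commutator A.derivation_closed)
  have leibniz: "bracket ?C x (r \<odot>\<^bsub>?C\<^esub> y) = r \<odot>\<^bsub>?C\<^esub> bracket ?C x y \<oplus>\<^bsub>?C\<^esub> anchor ?C x r \<odot>\<^bsub>?C\<^esub> y"
    if r: "r \<in> carrier R" and xy: "x \<in> carrier ?C" "y \<in> carrier ?C" for r x y
  proof -
    obtain D X where x: "x = (D, X)" and X: "X \<in> derivations K R" and D: "leibniz_map R N X D"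
      using xy(1) by (rule CDO_cases)
    obtain E Y where y: "y = (E, Y)" and Y: "Y \<in> derivations K R" and E: "leibniz_map R N Y E"
      using xy(2) by (rule CDO_cases)
    show ?thesis
      using self.commutator_scale_right[OF der(1)[OF X] _ der(3)[OF X] r, of Y]
        N.commutator_scale_right[OF D leibniz_map_additive[OF E] der(3)[OF X] r] der(2)[OF Y]
      by (simp add: x y CDO_simps cong: restrict_cong)
  qed
  have left: "bracket ?C (r \<odot>\<^bsub>?C\<^esub> x) y = r \<odot>\<^bsub>?C\<^esub> bracket ?C x y"
    if r: "r \<in> carrier R" "anchor ?C y r = \<zero>\<^bsub>R\<^esub>"
      and xy: "x \<in> carrier ?C" "y \<in> carrier ?C" for r x y
  proof -
    obtain D X where x: "x = (D, X)" and X: "X \<in> derivations K R" and D: "leibniz_map R N X D"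
      using xy(1) by (rule CDO_cases)
    obtain E Y where y: "y = (E, Y)" and Y: "Y \<in> derivations K R" and E: "leibniz_map R N Y E"
      using xy(2) by (rule CDO_cases)
    have "Y r = \<zero>\<^bsub>R\<^esub>" using r(2) by (simp add: y CDO_simps)
    then show ?thesis
      using self.commutator_scale_left[OF der(1)[OF X] der(1)[OF Y] r(1)]
        N.commutator_scale_left[OF D E r(1)]
      by (simp add: x y CDO_simps)
  qed
  have scalar: "anchor ?C x (k \<odot>\<^bsub>R\<^esub> \<one>\<^bsub>R\<^esub>) = \<zero>\<^bsub>R\<^esub>" if "k \<in> carrier K" "x \<in> carrier ?C" for k x
    using that by (auto elim!: CDO_cases simp: CDO_simps der)
  have lie: "lie_algebra K (restrict_scalars R ?C) (bracket ?C)"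
  proof (intro lie_algebra.intro lie_algebra_axioms.intro assms
      A.module_restrict_scalars[OF module_CDO], unfold restrict_scalars_simps, goal_cases)
    case (1 x y) then show ?case by (rule br_closed)
  next
    case (2 x y z) then show ?case
      by (auto elim!: CDO_cases simp: CDO_simps der leibniz_map_additive
        R.commutator_add_left N.M.commutator_add_left)
  next
    case (3 x y z) then show ?case
      by (auto elim!: CDO_cases simp: CDO_simps der leibniz_map_additive
        R.commutator_add_right N.M.commutator_add_right)
  next
    case (4 k x y) then show ?case by (intro left scalar) auto
  next
    case (5 k x y)
    then show ?case
      by (simp add: leibniz scalar br_closed)
  next
    case (6 x) then show ?case
      by (auto elim!: CDO_cases simp: CDO_simps der leibniz_map_additive
        R.commutator_self N.M.commutator_self)
  next
    case (7 x y z)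
    obtain D X where x: "x = (D, X)" and X: "X \<in> derivations K R" and D: "leibniz_map R N X D"
      using 7(1) by (rule CDO_cases)
    obtain E Y where y: "y = (E, Y)" and Y: "Y \<in> derivations K R" and E: "leibniz_map R N Y E"
      using 7(2) by (rule CDO_cases)
    obtain F Z where z: "z = (F, Z)" and Z: "Z \<in> derivations K R" and F: "leibniz_map R N Z F"
      using 7(3) by (rule CDO_cases)
    show ?case
      using R.commutator_jacobi[OF der(2)[OF X] der(2)[OF Y] der(2)[OF Z]]
        N.M.commutator_jacobi[OF D[THEN leibniz_map_additive] E[THEN leibniz_map_additive]
          F[THEN leibniz_map_additive]]
      by (simp add: x y z CDO_simps cong: restrict_cong)
  qed
  have "anchor ?C \<in> linear_maps R ?C (derivation_module K R)"
    by (auto elim!: CDO_cases simp: linear_maps_def derivation_module_def CDO_simps)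
  moreover have "anchor ?C (bracket ?C x y) = commutator R (anchor ?C x) (anchor ?C y)" for x y
    by (cases x; cases y) (simp add: CDO_simps)
  ultimately show ?thesis
    by (intro lie_rinehart_algebra.intro lie_rinehart_algebra_axioms.intro leibniz lie
        module_CDO A.algebra_axioms)
qed

end


section \<open>Lifting derivations to projective modules\<close>

text \<open>The entrywise action preserves finiteness of supports since \<open>X 0 = 0\<close>.\<close>

lemma free_module_derivation:
  assumes "algebra K R" and X: "X \<in> derivations K R" and c: "c \<in> carrier (free_module R I)"
  shows "(\<lambda>i\<in>I. X (c i)) \<in> carrier (free_module R I)"
proof -
  interpret algebra K R by fact
  have "finite {i\<in>I. (\<lambda>i\<in>I. X (c i)) i \<noteq> \<zero>\<^bsub>R\<^esub>}"
    by (rule finite_subset[of _ "{i\<in>I. c i \<noteq> \<zero>\<^bsub>R\<^esub>}"])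
       (use c derivation_zero[OF X] in \<open>auto simp: free_module_carrier\<close>)
  then show ?thesis
    using c derivation_closed[OF X] by (auto simp: free_module_carrier)
qed

text \<open>
  The lift is \<open>e \<circ> \<nabla> \<circ> s\<close>, for the evaluation \<open>e\<close> of formal combinations of elements of \<open>N\<close>, a linear
  section \<open>s\<close> of \<open>e\<close>, and the entrywise action \<open>\<nabla>\<close> of \<open>X\<close> on formal combinations. The section property
  is needed for the symbol: the term \<open>X(r) e(s(x))\<close> has to be \<open>X(r) x\<close>.
\<close>

lemma projective_module_lift_derivation:
  fixes R :: "('k, 'r) module" and N :: "('r, 'n) module"
  assumes R: "algebra K R" and N: "projective_module R N" and X: "X \<in> derivations K R"
  obtains D where "leibniz_map R N X D"
proof -
  interpret R: algebra K R by fact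
  interpret N: module R N using N by (simp add: projective_module_def)
  let ?F = "free_module R (carrier N)" and ?e = "lin_comb R N (carrier N) (\<lambda>x. x)"
  interpret F: module R ?F by (rule module_free_module[OF R.M_cring])
  obtain s where s: "s \<in> linear_maps R N ?F" and es: "\<And>x. x \<in> carrier N \<Longrightarrow> ?e (s x) = x"
    using projective_module_section[OF N] by blast
  have e: "?e \<in> linear_maps R ?F N" by (rule lin_comb_linear[OF N.module_axioms]) auto
  define nabla where "nabla = (\<lambda>c. \<lambda>i\<in>carrier N. X (c i))"
  define D where "D = (\<lambda>x\<in>carrier N. ?e (nabla (s x)))"
  have s_closed: "s x \<in> carrier ?F" if "x \<in> carrier N" for x
    using s that by (auto simp: linear_maps_def)
  have nabla_closed: "nabla c \<in> carrier ?F" if "c \<in> carrier ?F" for c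
    unfolding nabla_def by (rule free_module_derivation[OF R X that])
  have e_closed: "?e c \<in> carrier N" if "c \<in> carrier ?F" for c
    using e that by (auto simp: linear_maps_def)
  have entry: "c i \<in> carrier R" if "c \<in> carrier ?F" "i \<in> carrier N" for c i
    using that by (simp add: free_module_carrier)
  have X_closed: "X a \<in> carrier R" if "a \<in> carrier R" for a
    using R.derivation_closed[OF X] that by blast
  have nabla_add: "nabla (c \<oplus>\<^bsub>?F\<^esub> d) = nabla c \<oplus>\<^bsub>?F\<^esub> nabla d"
    if "c \<in> carrier ?F" "d \<in> carrier ?F" for c d
    using that entry R.additive_map_add[OF R.derivation_additive[OF X]]
    by (auto simp: nabla_def free_module_ops intro!: restrict_ext)
  have nabla_smult: "nabla (r \<odot>\<^bsub>?F\<^esub> c) = r \<odot>\<^bsub>?F\<^esub> nabla c \<oplus>\<^bsub>?F\<^esub> X r \<odot>\<^bsub>?F\<^esub> c"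
    if "r \<in> carrier R" "c \<in> carrier ?F" for r c
    using that entry leibniz_map_smult[OF R.derivation_leibniz_map[OF X]]
    by (auto simp: nabla_def free_module_ops intro!: restrict_ext)
  have add: "D (x \<oplus>\<^bsub>N\<^esub> y) = D x \<oplus>\<^bsub>N\<^esub> D y" if xy: "x \<in> carrier N" "y \<in> carrier N" for x y
  proof -
    have "s (x \<oplus>\<^bsub>N\<^esub> y) = s x \<oplus>\<^bsub>?F\<^esub> s y" using s xy by (simp add: linear_maps_def)
    then show ?thesis
      using e xy by (simp add: D_def nabla_add s_closed nabla_closed linear_maps_def)
  qed
  have smult: "D (r \<odot>\<^bsub>N\<^esub> x) = r \<odot>\<^bsub>N\<^esub> D x \<oplus>\<^bsub>N\<^esub> X r \<odot>\<^bsub>N\<^esub> x"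
    if rx: "r \<in> carrier R" "x \<in> carrier N" for r x
  proof -
    have "s (r \<odot>\<^bsub>N\<^esub> x) = r \<odot>\<^bsub>?F\<^esub> s x" using s rx by (simp add: linear_maps_def)
    then have "D (r \<odot>\<^bsub>N\<^esub> x) = r \<odot>\<^bsub>N\<^esub> ?e (nabla (s x)) \<oplus>\<^bsub>N\<^esub> X r \<odot>\<^bsub>N\<^esub> ?e (s x)"
      using e rx by (simp add: D_def nabla_smult s_closed nabla_closed X_closed linear_maps_def)
    then show ?thesis using rx by (simp add: D_def es)
  qed
  have "D \<in> extensional (carrier N)" "D \<in> carrier N \<rightarrow> carrier N"
    by (auto simp: D_def e_closed nabla_closed s_closed)
  with add smult have "leibniz_map R N X D" by (simp add: leibniz_map_def additive_map_def)
  then show ?thesis using that by blast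
qed

theorem proposition3p9:
  fixes K :: "'k ring" and R :: "('k, 'r) module" and N :: "('r, 'n) module"
  assumes "field K" and "characteristic_zero K"
    and "algebra K R"
    and "projective_module R N"
  shows "transitive_lie_rinehart_algebra K R (CDO K R N)"
proof -
  interpret algebra_module K R N
    using assms by (auto intro!: algebra_module.intro simp: projective_module_def)
  have "anchor (CDO K R N) ` carrier (CDO K R N) = derivations K R"
  proof (intro equalityI subsetI)
    fix X assume X: "X \<in> derivations K R"
    obtain D where "leibniz_map R N X D"
      by (rule projective_module_lift_derivation[OF assms(3,4) X])
    with X have "(D, X) \<in> carrier (CDO K R N)" by (simp add: CDO_carrier_iff)
    then show "X \<in> anchor (CDO K R N) ` carrier (CDO K R N)"
      by (force simp: CDO_simps)
  qed (auto elim!: CDO_cases simp: CDO_simps)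
  then show ?thesis
    by (intro transitive_lie_rinehart_algebra.intro transitive_lie_rinehart_algebra_axioms.intro
        lie_rinehart_CDO assms(1))
qed

end
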